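(* Consider the semi-discrete finite volume scheme for the three-dimensional special relativistic hydrodynamic (RHD) equations in curvilinear coordinates $$\frac{\mathrm d}{\mathrm dt}(J\boldsymbol U)_{\boldsymbol i}=-\sum_{k=1}^3\frac1{\Delta\xi_k}\Big(\widehat{\boldsymbol F}_{k,\hat{\boldsymbol i}_{k,+}}-\widehat{\boldsymbol F}_{k,\hat{\boldsymbol i}_{k,-}}\Big),\qquad \frac{\mathrm d}{\mathrm dt}J_{\boldsymbol i}=-\sum_{k=1}^3\frac1{\Delta\xi_k}\Big(\big(J\tfrac{\partial\xi_k}{\partial t}\big)_{\hat{\boldsymbol i}_{k,+}}-\big(J\tfrac{\partial\xi_k}{\partial t}\big)_{\hat{\boldsymbol i}_{k,-}}\Big),$$ with the setting and notation of the context; in particular the discrete spatial metrics $\big(J\frac{\partial\xi_k}{\partial x_l}\big)_{\hat{\boldsymbol i}_{k,\pm}}$ are given by the explicit formulas there. Assume that for each $k=1,2,3$ the symmetric two-point flux $\widetilde{\boldsymbol F}_{k,\hat{\boldsymbol i}_{k,\pm}}$ is consistent with $J\frac{\partial\xi_k}{\partial t}\boldsymbol U+\sum_{l=1}^3J\frac{\partial\xi_k}{\partial x_l}\boldsymbol F_l(\boldsymbol U)$ and satisfies at every interface $$[\![\boldsymbol V]\!]_{\hat{\boldsymbol i}_{k,\pm}}^{\mathrm T}\widetilde{\boldsymbol F}_{k,\hat{\boldsymbol i}_{k,\pm}}=\Big(J\frac{\partial\xi_k}{\partial t}\Big)_{\hat{\boldsymbol i}_{k,\pm}}[\![\phi]\!]_{\hat{\boldsymbol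 i}_{k,\pm}}+\sum_{l=1}^3\Big(J\frac{\partial\xi_k}{\partial x_l}\Big)_{\hat{\boldsymbol i}_{k,\pm}}[\![\psi_l]\!]_{\hat{\boldsymbol i}_{k,\pm}}.$$ Then the semi-discrete scheme with $\widehat{\boldsymbol F}_{k,\hat{\boldsymbol i}_{k,\pm}}=\widetilde{\boldsymbol F}_{k,\hat{\boldsymbol i}_{k,\pm}}$ is entropy conservative with the numerical entropy fluxes $$\widetilde q_{k,\hat{\boldsymbol i}_{k,\pm}}=\{\!\{\boldsymbol V\}\!\}_{\hat{\boldsymbol i}_{k,\pm}}^{\mathrm T}\widetilde{\boldsymbol F}_{k,\hat{\boldsymbol i}_{k,\pm}}-\Big(J\frac{\partial\xi_k}{\partial t}\Big)_{\hat{\boldsymbol i}_{k,\pm}}\{\!\{\phi\}\!\}_{\hat{\boldsymbol i}_{k,\pm}}-\sum_{l=1}^3\Big(J\frac{\partial\xi_k}{\partial x_l}\Big)_{\hat{\boldsymbol i}_{k,\pm}}\{\!\{\psi_l\}\!\}_{\hat{\boldsymbol i}_{k,\pm}};$$ that is, its solutions satisfy, for every cell $\boldsymbol i$, $$\frac{\mathrm d}{\mathrm dt}\big(J_{\boldsymbol i}\,\eta(\boldsymbol U_{\boldsymbol i}(t))\big)+\sum_{k=1}^3\frac1{\Delta\xi_k}\big(\widetilde q_{k,\hat{\boldsymbol i}_{k,+}}(t)-\widetilde q_{k,\hat{\boldsymbol i}_{k,-}}(t)\big)=0,$$ and $\widetilde q_k$ is consistent with the entropy flux $J\frac{\partial\xi_k}{\partial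 t}\eta+\sum_{l=1}^3J\frac{\partial\xi_k}{\partial x_l}q_l$.
   Context: RHD equations. The 3D special RHD equations are $\partial_t\boldsymbol U+\sum_{k=1}^3\partial_{x_k}\boldsymbol F_k(\boldsymbol U)=0$ with $\boldsymbol U=(D,\boldsymbol m^{\mathrm T},E)^{\mathrm T}\in\mathbb R^5$, $\boldsymbol F_k=(Dv_k,\ \boldsymbol m^{\mathrm T}v_k+p\,\boldsymbol e_k^{\mathrm T},\ m_k)^{\mathrm T}$, where $\rho>0$ is the rest-mass density, $p>0$ the pressure, $\boldsymbol v=(v_1,v_2,v_3)^{\mathrm T}$ the velocity with $|\boldsymbol v|<1$, $W=1/\sqrt{1-|\boldsymbol v|^2}$, $D=\rho W$, $\boldsymbol m=DhW\boldsymbol v$, $E=DhW-p$, $h=1+e+p/\rho$, and $\boldsymbol e_k$ is the $k$th standard basis vector of $\mathbb R^3$. The equation of state is $p=(\Gamma-1)\rho e$ with constant $\Gamma\in(1,2]$. All states are assumed to be physical in this sense; the primitive variables $(\rho,\boldsymbol v,p)$ are regarded as functions of $\boldsymbol U$. Entropy. With $s=\ln(p/\rho^\Gamma)$, set $\eta(\boldsymbol U)=-\rho Ws/(\Gamma-1)$ (convex in $\boldsymbol U$) and $q_k(\boldsymbol U)=\eta v_k$; these satisfy $q_k'(\boldsymbol U)=\eta'(\boldsymbol U)\boldsymbol F_k'(\boldsymbol U)$. The entropy variables are $$\boldsymbol V=\eta'(\boldsymbol U)^{\mathrm T}=\Big(\tfrac{\Gamma-s}{\Gamma-1}+\tfrac{\rho}{p},\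 \tfrac{\rho W\boldsymbol v^{\mathrm T}}{p},\ -\tfrac{\rho W}{p}\Big)^{\mathrm T}.$$ The potentials are $\phi=\boldsymbol V^{\mathrm T}\boldsymbol U-\eta=\rho W$ and $\psi_k=\boldsymbol V^{\mathrm T}\boldsymbol F_k-q_k=\rho Wv_k$. Curvilinear form. Under a time-dependent coordinate map $\boldsymbol x=\boldsymbol x(\boldsymbol\xi,t)$, with $J$ the Jacobian determinant, the system reads $\partial_t(J\boldsymbol U)+\sum_k\partial_{\xi_k}\big(J\frac{\partial\xi_k}{\partial t}\boldsymbol U\big)+\sum_{k,l}\partial_{\xi_k}\big(J\frac{\partial\xi_k}{\partial x_l}\boldsymbol F_l\big)=0$. Mesh. The computational domain is a uniform orthogonal mesh with constant step sizes $\Delta\xi_k$ and cells $\boldsymbol i=(i_1,i_2,i_3)$. The point $\hat{\boldsymbol i}_{k,\pm}$ is the midpoint of the face of cell $\boldsymbol i$ in the $\pm\xi_k$ direction (i.e. $i_k$ is replaced by $i_k\pm\frac12$), shared with the neighbouring cell. For a cell quantity $a$, $[\![a]\!]_{\hat{\boldsymbol i}_{k,+}}=a_{\boldsymbol i+\boldsymbol e_k}-a_{\boldsymbol i}$, $[\![a]\!]_{\hat{\boldsymbol i}_{k,-}}=a_{\boldsymbol i}-a_{\boldsymbol i-\boldsymbol e_k}$, $\{\!\{a\}\!\}_{\hat{\boldsymbol i}_{k,\pm}}=\frac12(a_{\boldsymbol i}+a_{\boldsymbol i\pm\boldsymbol e_k})$ (here $\boldsymbol e_k$ shifts the index $i_k$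 by one). The unknowns are $J_{\boldsymbol i}(t)>0$ and $(J\boldsymbol U)_{\boldsymbol i}(t)$, with $\boldsymbol U_{\boldsymbol i}=(J\boldsymbol U)_{\boldsymbol i}/J_{\boldsymbol i}$; $\boldsymbol V_{\boldsymbol i},\phi_{\boldsymbol i},\psi_{l,\boldsymbol i},\eta_{\boldsymbol i}$ are evaluated at $\boldsymbol U_{\boldsymbol i}$. Discrete metrics. $\boldsymbol x=(x_1,x_2,x_3)$ is given at the mesh vertices $(i_1+\frac12,i_2+\frac12,i_3+\frac12)$ at each time. For $m=1,2,3$ let $\delta_m$ be the central difference in the $i_m$-direction, $\delta_m[a]_{\cdots i_m\cdots}=a_{\cdots i_m+\frac12\cdots}-a_{\cdots i_m-\frac12\cdots}$, and $\mu_m$ the average in the $i_m$-direction, $\mu_m a_{\cdots i_m\cdots}=\frac12(a_{\cdots i_m+\frac12\cdots}+a_{\cdots i_m-\frac12\cdots})$. For $(k,a,b)$ a cyclic permutation of $(1,2,3)$ and $(l,r,c)$ a cyclic permutation of $(1,2,3)$, the interface spatial metric is $$\Big(J\frac{\partial\xi_k}{\partial x_l}\Big)_{\hat{\boldsymbol i}_{k,\pm}}=\frac1{\Delta\xi_a\Delta\xi_b}\Big(\delta_b\big[\delta_a[x_r]\,\mu_a x_c\big]-\delta_a\big[\delta_b[x_r]\,\mu_b x_c\big]\Big)_{\hat{\boldsymbol i}_{k,\pm}}.$$ These satisfy the discrete surface conservation laws $\sum_{k=1}^3\frac1{\Delta\xi_k}\Big(\big(J\frac{\partial\xi_k}{\partial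 x_l}\big)_{\hat{\boldsymbol i}_{k,+}}-\big(J\frac{\partial\xi_k}{\partial x_l}\big)_{\hat{\boldsymbol i}_{k,-}}\Big)=0$, $l=1,2,3$, in each cell. The interface temporal metrics $\big(J\frac{\partial\xi_k}{\partial t}\big)_{\hat{\boldsymbol i}_{k,\pm}}$ are given single values per interface (e.g. $-\sum_l(\dot x_l)_{\hat{\boldsymbol i}_{k,\pm}}\big(J\frac{\partial\xi_k}{\partial x_l}\big)_{\hat{\boldsymbol i}_{k,\pm}}$ with $\dot x_l$ the mesh velocity averaged over the four vertices of the face); the same values are used in the equation for $J_{\boldsymbol i}$ and in the flux condition. Two-point flux. $\widetilde{\boldsymbol F}_{k,\hat{\boldsymbol i}_{k,\pm}}$ is a function of the two states in the cells adjacent to the interface (and of the metrics at that interface), symmetric in the two states, with one value per interface. Consistency means that when both adjacent states equal $\boldsymbol U$, it equals $J\frac{\partial\xi_k}{\partial t}\boldsymbol U+\sum_lJ\frac{\partial\xi_k}{\partial x_l}\boldsymbol F_l(\boldsymbol U)$ with the interface metrics. Consistency of $\widetilde q_k$ is understood in the same way. Entropy conservative (EC) scheme: the semi-discrete scheme is EC if its solution satisfies $\frac{\mathrm d}{\mathrm dt}J_{\boldsymbol i}\eta(\boldsymbol U_{\boldsymbol i})+\sum_k\frac1{\Delta\xi_k}(\widetilde q_{k,\hat{\boldsymbol i}_{k,+}}-\widetilde q_{k,\hat{\boldsymbol i}_{k,-}})=0$ for some numerical entropy fluxes $\widetilde q_k$ consistent with $J\frac{\partial\xi_k}{\partial t}\eta+\sum_lJ\frac{\partial\xi_k}{\partial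 x_l}q_l$. *)

theory Defs
  imports "HOL-Analysis.Analysis"
begin

section \<open>Relativistic hydrodynamics with an ideal equation of state\<close>

text \<open>
  Vectors of \<open>\<real>\<^sup>5\<close> are written in block form \<open>(D, m, E)\<close>; the inner product on the product
  type is the Euclidean one, so \<open>V \<bullet> U\<close> is \<open>V\<^sup>T U\<close>. Primitive states \<open>(\<rho>, v, p)\<close> have the same type.
\<close>

type_synonym state = "real \<times> (real^3) \<times> real"

definition lorentz :: "real^3 \<Rightarrow> real" where
  "lorentz v = 1 / sqrt (1 - (norm v)\<^sup>2)"

text \<open>The equation of state \<open>p = (\<Gamma> - 1) \<rho> e\<close>, solved for \<open>e\<close>.\<close>

definition internal_energy :: "real \<Rightarrow> real \<Rightarrow> real \<Rightarrow> real" where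
  "internal_energy \<Gamma> \<rho> p = p / ((\<Gamma> - 1) * \<rho>)"

definition enthalpy :: "real \<Rightarrow> real \<Rightarrow> real \<Rightarrow> real" where
  "enthalpy \<Gamma> \<rho> p = 1 + internal_energy \<Gamma> \<rho> p + p / \<rho>"

definition physical_prim :: "state set" where
  "physical_prim = {(\<rho>, v, p). 0 < \<rho> \<and> norm v < 1 \<and> 0 < p}"

fun cons_of_prim :: "real \<Rightarrow> state \<Rightarrow> state" where
  "cons_of_prim \<Gamma> (\<rho>, v, p) =
    (let W = lorentz v; D = \<rho> * W; H = enthalpy \<Gamma> \<rho> p
     in (D, (D * H * W) *\<^sub>R v, D * H * W - p))"

definition physical :: "real \<Rightarrow> state set" where
  "physical \<Gamma> = cons_of_prim \<Gamma> ` physical_prim"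

text \<open>
  The primitive variables as functions of \<open>U\<close>; \<open>cons_of_prim \<Gamma>\<close> is injective on
  \<open>physical_prim\<close> for \<open>1 < \<Gamma> \<le> 2\<close>, so that the inverse is meaningful on \<open>physical \<Gamma>\<close>.
\<close>

definition prim_of_cons :: "real \<Rightarrow> state \<Rightarrow> state" where
  "prim_of_cons \<Gamma> = the_inv_into physical_prim (cons_of_prim \<Gamma>)"

definition rho :: "real \<Rightarrow> state \<Rightarrow> real" where
  "rho \<Gamma> U = fst (prim_of_cons \<Gamma> U)"

definition vel :: "real \<Rightarrow> state \<Rightarrow> real^3" where
  "vel \<Gamma> U = fst (snd (prim_of_cons \<Gamma> U))"

definition pres :: "real \<Rightarrow> state \<Rightarrow> real" where
  "pres \<Gamma> U = snd (snd (prim_of_cons \<Gamma> U))"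

definition flux :: "real \<Rightarrow> 3 \<Rightarrow> state \<Rightarrow> state" where
  "flux \<Gamma> k U =
    (case U of (D, m, E) \<Rightarrow>
      (D * vel \<Gamma> U $ k, (vel \<Gamma> U $ k) *\<^sub>R m + pres \<Gamma> U *\<^sub>R axis k 1, m $ k))"

definition spec_entropy :: "real \<Rightarrow> state \<Rightarrow> real" where
  "spec_entropy \<Gamma> U = ln (pres \<Gamma> U / rho \<Gamma> U powr \<Gamma>)"

definition eta :: "real \<Rightarrow> state \<Rightarrow> real" where
  "eta \<Gamma> U = - (rho \<Gamma> U * lorentz (vel \<Gamma> U) * spec_entropy \<Gamma> U) / (\<Gamma> - 1)"

definition entropy_flux :: "real \<Rightarrow> 3 \<Rightarrow> state \<Rightarrow> real" where
  "entropy_flux \<Gamma> k U = eta \<Gamma> U * vel \<Gamma> U $ k"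

text \<open>The gradient of \<open>eta \<Gamma>\<close> with respect to the conservative variables, in closed form.\<close>

definition entropy_vars :: "real \<Rightarrow> state \<Rightarrow> state" where
  "entropy_vars \<Gamma> U =
    (let \<rho> = rho \<Gamma> U; v = vel \<Gamma> U; p = pres \<Gamma> U; W = lorentz v; s = spec_entropy \<Gamma> U
     in ((\<Gamma> - s) / (\<Gamma> - 1) + \<rho> / p, (\<rho> * W / p) *\<^sub>R v, - (\<rho> * W / p)))"

text \<open>In terms of primitive variables, \<open>potential = \<rho> W\<close> and \<open>flux_potential k = \<rho> W v\<^sub>k\<close>.\<close>

definition potential :: "real \<Rightarrow> state \<Rightarrow> real" where
  "potential \<Gamma> U = entropy_vars \<Gamma> U \<bullet> U - eta \<Gamma> U"

definition flux_potential :: "real \<Rightarrow> 3 \<Rightarrow> state \<Rightarrow> real" where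
  "flux_potential \<Gamma> k U = entropy_vars \<Gamma> U \<bullet> flux \<Gamma> k U - entropy_flux \<Gamma> k U"


section \<open>Mesh and discrete metrics\<close>

text \<open>
  All mesh locations are points of \<open>\<real>\<^sup>3\<close> in index space: cells are integer points \<open>i\<close>, the faces of
  cell \<open>i\<close> in direction \<open>k\<close> sit at \<open>i \<plusminus> axis k (1/2)\<close>, and vertices are the points with all
  coordinates in \<open>\<int> + 1/2\<close>. Grid functions are total functions on \<open>\<real>\<^sup>3\<close>, used only at the
  locations where they are meant to live.
\<close>

definition cell_lattice :: "(real^3) set" where
  "cell_lattice = {i. \<forall>m. i $ m \<in> \<int>}"

definition delta :: "3 \<Rightarrow> (real^3 \<Rightarrow> 'a::real_vector) \<Rightarrow> real^3 \<Rightarrow> 'a" where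
  "delta m a P = a (P + axis m (1/2)) - a (P - axis m (1/2))"

definition mu :: "3 \<Rightarrow> (real^3 \<Rightarrow> 'a::real_vector) \<Rightarrow> real^3 \<Rightarrow> 'a" where
  "mu m a P = (1/2) *\<^sub>R (a (P + axis m (1/2)) + a (P - axis m (1/2)))"

text \<open>
  The metric \<open>J \<partial>\<xi>\<^sub>k/\<partial>x\<^sub>l\<close> at the point \<open>P\<close> (a face in direction \<open>k\<close>), from the vertex positions
  \<open>x\<close>. Arithmetic in the index type \<open>3\<close> is modulo 3, so \<open>(k, k + 1, k + 2)\<close> runs through the
  cyclic permutations of \<open>(1, 2, 3)\<close>.
\<close>

definition spatial_metric ::
  "real^3 \<Rightarrow> (real^3 \<Rightarrow> real^3) \<Rightarrow> 3 \<Rightarrow> 3 \<Rightarrow> real^3 \<Rightarrow> real" where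
  "spatial_metric \<Delta>\<xi> x k l P =
    (let a = k + 1; b = k + 2;
         xr = (\<lambda>Q. x Q $ (l + 1)); xc = (\<lambda>Q. x Q $ (l + 2))
     in 1 / (\<Delta>\<xi> $ a * \<Delta>\<xi> $ b) *
        (delta b (\<lambda>Q. delta a xr Q * mu a xc Q) P - delta a (\<lambda>Q. delta b xr Q * mu b xc Q) P))"

definition metric_row :: "real^3 \<Rightarrow> (real^3 \<Rightarrow> real^3) \<Rightarrow> 3 \<Rightarrow> real^3 \<Rightarrow> real^3" where
  "metric_row \<Delta>\<xi> x k P = (\<chi> l. spatial_metric \<Delta>\<xi> x k l P)"

text \<open>
  The cells carrying the scheme form a set \<open>C\<close>, either the whole lattice or a part of it; the
  neighbours outside \<open>C\<close> then play the role of ghost cells.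
\<close>

definition interfaces :: "(real^3) set \<Rightarrow> (3 \<times> (real^3)) set" where
  "interfaces C = {(k, P). P - axis k (1/2) \<in> C \<or> P + axis k (1/2) \<in> C}"

definition cells_and_neighbours :: "(real^3) set \<Rightarrow> (real^3) set" where
  "cells_and_neighbours C = C \<union> {i. \<exists>k. i - axis k 1 \<in> C \<or> i + axis k 1 \<in> C}"


section \<open>Two-point fluxes\<close>

text \<open>
  A two-point flux maps the temporal metric \<open>a = J \<partial>\<xi>\<^sub>k/\<partial>t\<close>, the spatial metrics
  \<open>b\<^sub>l = J \<partial>\<xi>\<^sub>k/\<partial>x\<^sub>l\<close> of an interface and the states on its lower and upper side to the value at
  that interface. It is vector-valued for the numerical flux and scalar for the entropy flux.
\<close>

type_synonym 'a two_point = "real \<Rightarrow> real^3 \<Rightarrow> state \<Rightarrow> state \<Rightarrow> 'a"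

definition symmetric_flux :: "real \<Rightarrow> 'a two_point \<Rightarrow> real \<Rightarrow> real^3 \<Rightarrow> bool" where
  "symmetric_flux \<Gamma> f a b \<longleftrightarrow>
    (\<forall>U\<in>physical \<Gamma>. \<forall>U'\<in>physical \<Gamma>. f a b U U' = f a b U' U)"

definition consistent_flux ::
  "real \<Rightarrow> 'a::real_vector two_point \<Rightarrow> (state \<Rightarrow> 'a) \<Rightarrow> (3 \<Rightarrow> state \<Rightarrow> 'a) \<Rightarrow> real \<Rightarrow> real^3 \<Rightarrow> bool" where
  "consistent_flux \<Gamma> f u g a b \<longleftrightarrow>
    (\<forall>U\<in>physical \<Gamma>. f a b U U = a *\<^sub>R u U + (\<Sum>l\<in>UNIV. (b $ l) *\<^sub>R g l U))"

definition ec_condition ::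
  "real \<Rightarrow> state two_point \<Rightarrow> real \<Rightarrow> real^3 \<Rightarrow> state \<Rightarrow> state \<Rightarrow> bool" where
  "ec_condition \<Gamma> f a b UL UR \<longleftrightarrow>
    (entropy_vars \<Gamma> UR - entropy_vars \<Gamma> UL) \<bullet> f a b UL UR =
      a * (potential \<Gamma> UR - potential \<Gamma> UL)
      + (\<Sum>l\<in>UNIV. b $ l * (flux_potential \<Gamma> l UR - flux_potential \<Gamma> l UL))"

definition num_entropy_flux :: "real \<Rightarrow> state two_point \<Rightarrow> real two_point" where
  "num_entropy_flux \<Gamma> f a b UL UR =
    ((1/2) *\<^sub>R (entropy_vars \<Gamma> UL + entropy_vars \<Gamma> UR)) \<bullet> f a b UL UR
    - a * ((potential \<Gamma> UL + potential \<Gamma> UR) / 2)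
    - (\<Sum>l\<in>UNIV. b $ l * ((flux_potential \<Gamma> l UL + flux_potential \<Gamma> l UR) / 2))"


section \<open>Semi-discrete scheme\<close>

definition cell_state ::
  "(real^3 \<Rightarrow> real \<Rightarrow> real) \<Rightarrow> (real^3 \<Rightarrow> real \<Rightarrow> state) \<Rightarrow> real^3 \<Rightarrow> real \<Rightarrow> state" where
  "cell_state J JU i t = JU i t /\<^sub>R J i t"

text \<open>
  Value of the two-point flux \<open>f k\<close> at the \<open>k\<close>-face \<open>P\<close> at time \<open>t\<close>, for vertex positions \<open>x\<close>,
  temporal interface metrics \<open>Jt\<close> and cell states \<open>U\<close>.
\<close>

definition interface_value ::
  "real^3 \<Rightarrow> (real \<Rightarrow> real^3 \<Rightarrow> real^3) \<Rightarrow> (3 \<Rightarrow> real^3 \<Rightarrow> real \<Rightarrow> real) \<Rightarrow>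
    (real^3 \<Rightarrow> real \<Rightarrow> state) \<Rightarrow> (3 \<Rightarrow> 'a two_point) \<Rightarrow> 3 \<Rightarrow> real^3 \<Rightarrow> real \<Rightarrow> 'a" where
  "interface_value \<Delta>\<xi> x Jt U f k P t =
    f k (Jt k P t) (metric_row \<Delta>\<xi> (x t) k P) (U (P - axis k (1/2)) t) (U (P + axis k (1/2)) t)"

definition flux_difference ::
  "real^3 \<Rightarrow> (3 \<Rightarrow> real^3 \<Rightarrow> real \<Rightarrow> 'a::real_vector) \<Rightarrow> real^3 \<Rightarrow> real \<Rightarrow> 'a" where
  "flux_difference \<Delta>\<xi> F i t =
    (\<Sum>k\<in>UNIV. (1 / \<Delta>\<xi> $ k) *\<^sub>R (F k (i + axis k (1/2)) t - F k (i - axis k (1/2)) t))"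

definition solves_scheme ::
  "real^3 \<Rightarrow> (real^3) set \<Rightarrow> real set \<Rightarrow> (3 \<Rightarrow> real^3 \<Rightarrow> real \<Rightarrow> real) \<Rightarrow> (3 \<Rightarrow> real^3 \<Rightarrow> real \<Rightarrow> state) \<Rightarrow>
    (real^3 \<Rightarrow> real \<Rightarrow> real) \<Rightarrow> (real^3 \<Rightarrow> real \<Rightarrow> state) \<Rightarrow> bool" where
  "solves_scheme \<Delta>\<xi> C T Jt F J JU \<longleftrightarrow>
    (\<forall>i\<in>C. \<forall>t\<in>T.
      (JU i has_vector_derivative - flux_difference \<Delta>\<xi> F i t) (at t within T) \<and>
      (J i has_real_derivative - flux_difference \<Delta>\<xi> Jt i t) (at t within T))"

definition satisfies_entropy_balance ::
  "real \<Rightarrow> real^3 \<Rightarrow> (real^3) set \<Rightarrow> real set \<Rightarrow> (3 \<Rightarrow> real^3 \<Rightarrow> real \<Rightarrow> real) \<Rightarrow>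
    (real^3 \<Rightarrow> real \<Rightarrow> real) \<Rightarrow> (real^3 \<Rightarrow> real \<Rightarrow> state) \<Rightarrow> bool" where
  "satisfies_entropy_balance \<Gamma> \<Delta>\<xi> C T q J JU \<longleftrightarrow>
    (\<forall>i\<in>C. \<forall>t\<in>T.
      ((\<lambda>\<tau>. J i \<tau> * eta \<Gamma> (cell_state J JU i \<tau>)) has_real_derivative
        - flux_difference \<Delta>\<xi> q i t) (at t within T))"

end

theory Submission
  imports Defs
begin

text \<open>
  The product rule and the two evolution equations turn the rate of change of \<open>J \<eta>(U)\<close> in a cell
  into \<open>V\<^sup>T (JU)' - \<phi> J'\<close>, provided that \<open>V\<close> really is the gradient of \<open>\<eta>\<close>: the remaining
  coefficient of \<open>J'\<close> is \<open>\<eta> - V\<^sup>T U = - \<phi>\<close>. At a face, the mean and the jump of \<open>V\<close> recover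
  the value of \<open>V\<close> in either adjacent cell, so the flux condition gives
  \<open>V\<^sup>T F = q + a \<phi> + \<Sum>\<^sub>l b\<^sub>l \<psi>\<^sub>l\<close> with the single face value \<open>q\<close> of the entropy flux and the
  potentials of that cell (\<open>cell_entropy_flux\<close>). Summed over the faces of the cell, the terms with
  \<open>\<phi>\<close> cancel against the equation for \<open>J\<close>, the terms with \<open>\<psi>\<^sub>l\<close> cancel by the discrete surface
  conservation laws (\<open>surface_conservation_law\<close>), and only the difference of the entropy fluxes
  survives. Those laws hold because the metrics are a discrete curl whose difference operators
  commute.

  The analytic core is that \<open>\<eta>\<close> is differentiable with gradient \<open>V\<close>, although the map
  \<open>U \<mapsto> (\<rho>, v, p)\<close> has no closed form. No Jacobian is inverted. Instead, \<open>\<eta>\<close> lies strictly above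
  its tangents with slope \<open>V\<close> (\<open>entropy_of_prim_strictly_above_tangent\<close>), which is an inequality
  between explicit functions of two primitive states. It has two consequences. First,
  distinct primitive states have distinct conservative states, for otherwise the inequality, used
  with the two states in both orders, would give both \<open>\<eta> < \<eta>'\<close> and \<open>\<eta>' < \<eta>\<close>; then invariance of
  domain makes the primitive variables, and with them \<open>V\<close>, continuous in \<open>U\<close>. Secondly, \<open>V\<close> is a
  subgradient of \<open>\<eta>\<close>, and a function with a continuous subgradient is differentiable.
\<close>

section \<open>Strict convexity of the entropy in terms of primitive variables\<close>

definition entropy_of_prim :: "real \<Rightarrow> state \<Rightarrow> real" where
  "entropy_of_prim \<Gamma> Q =
    (case Q of (\<rho>, v, p) \<Rightarrow> - (\<rho> * lorentz v * ln (p / \<rho> powr \<Gamma>)) / (\<Gamma> - 1))"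

definition entropy_vars_of_prim :: "real \<Rightarrow> state \<Rightarrow> state" where
  "entropy_vars_of_prim \<Gamma> Q =
    (case Q of (\<rho>, v, p) \<Rightarrow>
      ((\<Gamma> - ln (p / \<rho> powr \<Gamma>)) / (\<Gamma> - 1) + \<rho> / p,
       (\<rho> * lorentz v / p) *\<^sub>R v,
       - (\<rho> * lorentz v / p)))"

lemma eta_eq_entropy_of_prim: "eta \<Gamma> U = entropy_of_prim \<Gamma> (prim_of_cons \<Gamma> U)"
  by (simp add: eta_def entropy_of_prim_def spec_entropy_def rho_def vel_def pres_def split_beta)

lemma entropy_vars_eq_of_prim:
  "entropy_vars \<Gamma> U = entropy_vars_of_prim \<Gamma> (prim_of_cons \<Gamma> U)"
  by (simp add: entropy_vars_def entropy_vars_of_prim_def spec_entropy_def rho_def vel_def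
      pres_def split_beta Let_def)

lemma one_minus_norm_sq_pos: "norm (v::real^3) < 1 \<Longrightarrow> 0 < 1 - (norm v)\<^sup>2"
  by (simp add: abs_square_less_1)

lemma lorentz_pos: "norm v < 1 \<Longrightarrow> 0 < lorentz v"
  using one_minus_norm_sq_pos[of v] by (simp add: lorentz_def)

lemma lorentz_sq: "norm v < 1 \<Longrightarrow> (lorentz v)\<^sup>2 * (1 - v \<bullet> v) = 1"
  using one_minus_norm_sq_pos[of v]
  by (simp add: lorentz_def power_divide power2_norm_eq_inner)

text \<open>
  The factor \<open>W W' (1 - v\<^sup>T v')\<close> is the Lorentz factor of the relative velocity, up to sign the
  Minkowski product of the two four-velocities. The identity bounds it from below by
  \<open>(w + 1 / w) / 2\<close>, with equality only for \<open>v = v'\<close>.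
\<close>

lemma relative_lorentz_eq:
  fixes v v' :: "real^3"
  assumes "norm v < 1" "norm v' < 1"
  defines "w \<equiv> lorentz v / lorentz v'"
  shows "2 * (lorentz v * lorentz v' * (1 - v \<bullet> v'))
       = w + 1 / w + lorentz v * lorentz v' * (norm (v - v'))\<^sup>2"
proof -
  define W W' where "W = lorentz v" and "W' = lorentz v'"
  have pos: "0 < W" "0 < W'"
    using assms lorentz_pos by (auto simp: W_def W'_def)
  have sq: "W\<^sup>2 * (1 - v \<bullet> v) = 1" "W'\<^sup>2 * (1 - v' \<bullet> v') = 1"
    using assms lorentz_sq by (auto simp: W_def W'_def)
  have "w = w * (W'\<^sup>2 * (1 - v' \<bullet> v'))"
    using sq by simp
  also have "\<dots> = W * W' * (1 - v' \<bullet> v')"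
    using pos by (simp add: w_def power2_eq_square flip: W_def W'_def)
  finally have w: "w = W * W' * (1 - v' \<bullet> v')" .
  have "1 / w = 1 / w * (W\<^sup>2 * (1 - v \<bullet> v))"
    using sq by simp
  also have "\<dots> = W * W' * (1 - v \<bullet> v)"
    using pos by (simp add: w_def power2_eq_square flip: W_def W'_def)
  finally have w_inv: "1 / w = W * W' * (1 - v \<bullet> v)" .
  show ?thesis
    unfolding w_inv unfolding w
    by (simp add: power2_norm_eq_inner inner_diff_left inner_diff_right inner_commute algebra_simps
        flip: W_def W'_def)
qed

lemma add_inverse_eq: "0 < w \<Longrightarrow> w + 1 / w = 2 + (w - 1)\<^sup>2 / w" for w :: real
proof -
  assume "0 < w"
  then have "w + 1 / w - 2 = (w - 1)\<^sup>2 / w"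
    by (simp add: field_simps power2_eq_square)
  then show ?thesis by linarith
qed

text \<open>
  The relative entropy of two states, up to a positive factor, as a function of the density ratio
  \<open>r\<close>, the pressure ratio \<open>q\<close>, the ratio \<open>w\<close> of Lorentz factors and the relative Lorentz factor
  \<open>\<gamma>\<close>. The inequality comes from \<open>ln X \<le> X - 1\<close> at \<open>r q\<close>, \<open>r q / w\<close> and \<open>r w\<close>. The lower bound on
  \<open>\<gamma>\<close> enters through
  \<open>\<Gamma> \<gamma> - (\<Gamma> - 1) w = (2 - \<Gamma>) \<gamma> + (\<Gamma> - 1) (2 \<gamma> - w) \<ge> (2 - \<Gamma>) + (\<Gamma> - 1) / w\<close>,
  which is where \<open>\<Gamma> \<le> 2\<close> matters.
\<close>

lemma relative_entropy_scalar_pos: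
  fixes \<Gamma> r q w \<gamma> z :: real
  assumes \<Gamma>: "1 < \<Gamma>" "\<Gamma> \<le> 2"
    and pos: "0 < r" "0 < q" "0 < w" "0 < z"
    and \<gamma>: "w + 1 / w \<le> 2 * \<gamma>"
    and neq: "1 < \<gamma> \<or> r \<noteq> 1 \<or> q \<noteq> 1"
  shows "0 < - ln q - \<Gamma> * ln r - \<Gamma> + (\<Gamma> - 1) * z * (\<gamma> - 1)
             + r * q * (\<Gamma> * \<gamma> - (\<Gamma> - 1) * w) + (\<Gamma> - 1) * r * w"
    (is "0 < ?K")
proof -
  define R where "R = (\<lambda>X::real. X - 1 - ln X)"
  have R: "0 \<le> R X" if "0 < X" for X
    using ln_le_minus_one[OF that] by (simp add: R_def)
  have R_zero: "X = 1" if "0 < X" "R X = 0" for X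
    using ln_eq_minus_one[OF that(1)] that(2) by (simp add: R_def)
  have w_sq: "w + 1 / w = 2 + (w - 1)\<^sup>2 / w"
    using pos by (simp add: add_inverse_eq)
  moreover have "0 \<le> (w - 1)\<^sup>2 / w" using pos by simp
  ultimately have \<gamma>1: "1 \<le> \<gamma>" using \<gamma> by simp
  define A where "A = (\<Gamma> - 1) * z * (\<gamma> - 1)"
  define B where "B = r * q * ((2 - \<Gamma>) * (\<gamma> - 1) + (\<Gamma> - 1) * (2 * \<gamma> - w - 1 / w))"
  have "0 \<le> A" using \<Gamma> pos \<gamma>1 by (simp add: A_def)
  have "0 \<le> B" using \<Gamma> pos \<gamma>1 \<gamma> by (simp add: B_def)
  have lns: "ln (r * q) = ln r + ln q" "ln (r * q / w) = ln r + ln q - ln w"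
    "ln (r * w) = ln r + ln w"
    using pos by (simp_all add: ln_mult ln_div)
  \<comment> \<open>With the weights \<open>2 - \<Gamma>\<close>, \<open>\<Gamma> - 1\<close>, \<open>\<Gamma> - 1\<close> the logarithms add up to \<open>- ln q - \<Gamma> ln r\<close> and the
    constants to \<open>- \<Gamma>\<close>.\<close>
  have K: "?K = (2 - \<Gamma>) * R (r * q) + (\<Gamma> - 1) * R (r * q / w) + (\<Gamma> - 1) * R (r * w) + A + B"
    unfolding R_def A_def B_def lns by (simp add: algebra_simps)
  have nonneg: "0 \<le> (2 - \<Gamma>) * R (r * q)" "0 \<le> (\<Gamma> - 1) * R (r * q / w)" "0 \<le> (\<Gamma> - 1) * R (r * w)"
    using \<Gamma> pos R by simp_all
  show ?thesis
  proof (rule ccontr)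
    assume "\<not> 0 < ?K"
    with K nonneg \<open>0 \<le> A\<close> \<open>0 \<le> B\<close>
    have zero: "A = 0" "(\<Gamma> - 1) * R (r * q / w) = 0" "(\<Gamma> - 1) * R (r * w) = 0"
      by linarith+
    from zero(1) have "\<gamma> = 1" using \<Gamma> pos by (simp add: A_def)
    with \<gamma> w_sq have "(w - 1)\<^sup>2 / w \<le> 0" by simp
    then have "w = 1" using pos by (simp add: divide_le_0_iff)
    with zero \<Gamma> have "R (r * q) = 0" "R r = 0" by simp_all
    with R_zero pos have "r = 1" "r * q = 1" by simp_all
    with \<open>\<gamma> = 1\<close> neq show False by simp
  qed
qed

lemma entropy_vars_inner_cons_of_prim:
  assumes Q: "(\<rho>, v, p) \<in> physical_prim" and Q': "(\<rho>', v', p') \<in> physical_prim" and "1 < \<Gamma>"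
  shows "entropy_vars_of_prim \<Gamma> (\<rho>, v, p) \<bullet> cons_of_prim \<Gamma> (\<rho>', v', p')
    = ((\<Gamma> - ln (p / \<rho> powr \<Gamma>)) / (\<Gamma> - 1) + \<rho> / p) * (\<rho>' * lorentz v')
      - \<rho> / p * lorentz v' * (lorentz v * lorentz v' * (1 - v \<bullet> v')) * (\<rho>' + \<Gamma> / (\<Gamma> - 1) * p')
      + \<rho> * lorentz v * p' / p"
proof -
  define W W' where "W = lorentz v" and "W' = lorentz v'"
  define s where "s = ln (p / \<rho> powr \<Gamma>)"
  define d where "d = v \<bullet> v'"
  define H where "H = \<rho>' + \<Gamma> / (\<Gamma> - 1) * p'"
  have pos: "0 < \<rho>'" "0 < p" "0 < \<Gamma> - 1"
    using assms by (auto simp: physical_prim_def)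
  have "\<rho>' * enthalpy \<Gamma> \<rho>' p' = H"
    using pos unfolding H_def enthalpy_def internal_energy_def by (simp add: divide_simps) (simp add: algebra_simps)
  then have H: "\<rho>' * W' * enthalpy \<Gamma> \<rho>' p' * W' = W' * W' * H"
    by (auto simp: ac_simps)
  have "entropy_vars_of_prim \<Gamma> (\<rho>, v, p) \<bullet> cons_of_prim \<Gamma> (\<rho>', v', p')
    = ((\<Gamma> - s) / (\<Gamma> - 1) + \<rho> / p) * (\<rho>' * W') + \<rho> * W / p * (W' * W' * H * d)
      - \<rho> * W / p * (W' * W' * H - p')"
    by (simp add: entropy_vars_of_prim_def Let_def H flip: W_def W'_def s_def d_def)
  moreover have "\<rho> * W / p = \<rho> / p * W" "\<rho> * W * p' / p = \<rho> / p * W * p'"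
    by simp_all
  moreover have "Y + z * W * (W' * W' * H * d) - z * W * (W' * W' * H - p')
      = Y - z * W' * (W * W' * (1 - d)) * H + z * W * p'" for Y z
    by (simp add: algebra_simps)
  ultimately show ?thesis
    unfolding W_def[symmetric] W'_def[symmetric] s_def[symmetric] d_def[symmetric] H_def[symmetric]
    by presburger
qed

lemma potential_of_prim:
  assumes "(\<rho>, v, p) \<in> physical_prim" "1 < \<Gamma>"
  shows "entropy_vars_of_prim \<Gamma> (\<rho>, v, p) \<bullet> cons_of_prim \<Gamma> (\<rho>, v, p)
         - entropy_of_prim \<Gamma> (\<rho>, v, p) = \<rho> * lorentz v"
proof -
  have pos: "0 < \<rho>" "0 < p" "0 < \<Gamma> - 1" and v: "norm v < 1"
    using assms by (auto simp: physical_prim_def)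
  have "lorentz v * lorentz v * (1 - v \<bullet> v) = 1"
    using lorentz_sq[OF v] by (simp add: power2_eq_square)
  then have V: "entropy_vars_of_prim \<Gamma> (\<rho>, v, p) \<bullet> cons_of_prim \<Gamma> (\<rho>, v, p)
    = ((\<Gamma> - ln (p / \<rho> powr \<Gamma>)) / (\<Gamma> - 1) + \<rho> / p) * (\<rho> * lorentz v)
      - \<rho> / p * lorentz v * (\<rho> + \<Gamma> / (\<Gamma> - 1) * p) + \<rho> * lorentz v"
    unfolding entropy_vars_inner_cons_of_prim[OF assms(1,1,2)] using pos by simp
  have common: "\<rho> / p * lorentz v * (\<rho> + \<Gamma> / (\<Gamma> - 1) * p)
    = (\<rho> / p + \<Gamma> / (\<Gamma> - 1)) * (\<rho> * lorentz v)"
    using pos by (simp add: distrib_left distrib_right ac_simps)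
  have "((\<Gamma> - s) / c + z) * X - (z + \<Gamma> / c) * X + X - - (X * s) / c = X" for s c z X :: real
    by (simp add: diff_divide_distrib algebra_simps)
  then show ?thesis
    unfolding V common entropy_of_prim_def prod.case by this
qed

text \<open>
  The left-hand side is \<open>\<Gamma> - 1\<close> times \<open>\<eta>' - \<eta> - V\<^sup>T (U' - U)\<close>, because \<open>V\<^sup>T U - \<eta> = \<rho> W\<close>.
  Dividing by \<open>\<rho>' W'\<close> leaves only ratios and the relative Lorentz factor, apart from \<open>z\<close>, whose
  sign is all that matters later.
\<close>

lemma relative_entropy_of_prim:
  assumes Q: "(\<rho>, v, p) \<in> physical_prim" and Q': "(\<rho>', v', p') \<in> physical_prim" and "1 < \<Gamma>"
  defines "r \<equiv> \<rho> / \<rho>'" and "q \<equiv> p' / p" and "w \<equiv> lorentz v / lorentz v'" and "z \<equiv> \<rho> / p"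
    and "\<gamma> \<equiv> lorentz v * lorentz v' * (1 - v \<bullet> v')"
  shows "(\<Gamma> - 1) * (entropy_of_prim \<Gamma> (\<rho>', v', p')
           - entropy_vars_of_prim \<Gamma> (\<rho>, v, p) \<bullet> cons_of_prim \<Gamma> (\<rho>', v', p') + \<rho> * lorentz v)
    = \<rho>' * lorentz v' * (- ln q - \<Gamma> * ln r - \<Gamma> + (\<Gamma> - 1) * z * (\<gamma> - 1)
             + r * q * (\<Gamma> * \<gamma> - (\<Gamma> - 1) * w) + (\<Gamma> - 1) * r * w)"
proof -
  define W W' where "W = lorentz v" and "W' = lorentz v'"
  define s s' where "s = ln (p / \<rho> powr \<Gamma>)" and "s' = ln (p' / \<rho>' powr \<Gamma>)"
  have pos: "0 < \<rho>" "0 < p" "0 < \<rho>'" "0 < p'" "0 < \<Gamma> - 1" "0 < W" "0 < W'"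
    using assms lorentz_pos by (auto simp: physical_prim_def W_def W'_def)
  have \<gamma>: "\<gamma> = W * W' * (1 - v \<bullet> v')" by (simp add: \<gamma>_def W_def W'_def)
  have "- ln q - \<Gamma> * ln r = s - s'"
    using pos by (simp add: q_def r_def s_def s'_def ln_div ln_powr algebra_simps)
  \<comment> \<open>The left-hand side is the one of the claim, with \<open>V\<^sup>T U'\<close> written out.\<close>
  moreover have "(\<Gamma> - 1) * (- (\<rho>' * W' * s') / (\<Gamma> - 1)
      - (((\<Gamma> - s) / (\<Gamma> - 1) + \<rho> / p) * (\<rho>' * W') - \<rho> / p * W' * \<gamma> * (\<rho>' + \<Gamma> / (\<Gamma> - 1) * p')
         + \<rho> * W * p' / p) + \<rho> * W)
    = \<rho>' * W' * (s - s' - \<Gamma> + (\<Gamma> - 1) * z * (\<gamma> - 1)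
        + r * q * (\<Gamma> * \<gamma> - (\<Gamma> - 1) * w) + (\<Gamma> - 1) * r * w)"
  proof -
    have cancel: "(\<Gamma> - 1) * (a / (\<Gamma> - 1)) = a" for a using pos by simp
    have "z * W' * \<gamma> * (\<rho>' + k * p') = \<rho>' * W' * (z * \<gamma>) + k * W' * \<gamma> * (z * p')" for k
      by (simp add: algebra_simps)
    moreover have "z * p' = \<rho>' * (r * q)"
      using pos by (simp add: z_def r_def q_def)
    ultimately have "\<rho> / p * W' * \<gamma> * (\<rho>' + \<Gamma> / (\<Gamma> - 1) * p')
        = \<rho>' * W' * (z * \<gamma> + \<Gamma> / (\<Gamma> - 1) * (r * q * \<gamma>))"
      by (simp only: z_def[symmetric]) (simp only: distrib_left mult_ac)
    moreover have "\<rho> * W * p' / p = \<rho>' * W' * (r * q * w)" and "\<rho> * W = \<rho>' * W' * (r * w)"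
      using pos by (simp_all add: r_def q_def w_def flip: W_def W'_def)
    moreover have expand: "- (X * s') / c - (((\<Gamma> - s) / c + z) * X - X * (z * \<gamma> + \<Gamma> / c * A) + X * B) + X * D
      = X * ((s - s' - \<Gamma>) / c + z * (\<gamma> - 1) + \<Gamma> / c * A - B + D)" for X A B D c
      by (simp add: algebra_simps diff_divide_distrib add_divide_distrib)
    ultimately have "- (\<rho>' * W' * s') / (\<Gamma> - 1)
      - (((\<Gamma> - s) / (\<Gamma> - 1) + \<rho> / p) * (\<rho>' * W') - \<rho> / p * W' * \<gamma> * (\<rho>' + \<Gamma> / (\<Gamma> - 1) * p')
         + \<rho> * W * p' / p) + \<rho> * W
      = \<rho>' * W' * ((s - s' - \<Gamma>) / (\<Gamma> - 1) + z * (\<gamma> - 1)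
          + \<Gamma> / (\<Gamma> - 1) * (r * q * \<gamma>) - r * q * w + r * w)"
      by (simp only: z_def[symmetric] expand)
    also have "(\<Gamma> - 1) * \<dots> = \<rho>' * W' * ((\<Gamma> - 1) * ((s - s' - \<Gamma>) / (\<Gamma> - 1))
          + (\<Gamma> - 1) * z * (\<gamma> - 1) + (\<Gamma> - 1) * (\<Gamma> / (\<Gamma> - 1)) * (r * q * \<gamma>)
          - (\<Gamma> - 1) * (r * q * w) + (\<Gamma> - 1) * r * w)"
      by (simp only: distrib_left right_diff_distrib mult.assoc mult.left_commute[of "\<Gamma> - 1"])
    also have "\<dots> = \<rho>' * W' * (s - s' - \<Gamma> + (\<Gamma> - 1) * z * (\<gamma> - 1)
        + r * q * (\<Gamma> * \<gamma> - (\<Gamma> - 1) * w) + (\<Gamma> - 1) * r * w)"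
      unfolding cancel by (simp add: algebra_simps)
    finally show ?thesis .
  qed
  ultimately show ?thesis
    unfolding entropy_vars_inner_cons_of_prim[OF Q Q' \<open>1 < \<Gamma>\<close>] entropy_of_prim_def prod.case
      W_def[symmetric] W'_def[symmetric] s_def[symmetric] s'_def[symmetric] \<gamma>[symmetric]
    by (simp only:)
qed

lemma entropy_of_prim_strictly_above_tangent:
  assumes Q: "Q \<in> physical_prim" and Q': "Q' \<in> physical_prim" and neq: "Q \<noteq> Q'"
    and \<Gamma>: "1 < \<Gamma>" "\<Gamma> \<le> 2"
  shows "entropy_vars_of_prim \<Gamma> Q \<bullet> (cons_of_prim \<Gamma> Q' - cons_of_prim \<Gamma> Q)
         < entropy_of_prim \<Gamma> Q' - entropy_of_prim \<Gamma> Q"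
proof -
  obtain \<rho> v p where Qe: "Q = (\<rho>, v, p)" by (cases Q)
  obtain \<rho>' v' p' where Qe': "Q' = (\<rho>', v', p')" by (cases Q')
  define r q w z \<gamma> where "r = \<rho> / \<rho>'" and "q = p' / p" and "w = lorentz v / lorentz v'"
    and "z = \<rho> / p" and "\<gamma> = lorentz v * lorentz v' * (1 - v \<bullet> v')"
  have pos: "0 < \<rho>" "0 < p" "0 < \<rho>'" "0 < p'" and v: "norm v < 1" "norm v' < 1"
    using Q Q' by (auto simp: physical_prim_def Qe Qe')
  have W: "0 < lorentz v" "0 < lorentz v'" using v lorentz_pos by auto
  have w: "0 < w" using W by (simp add: w_def)
  have g: "2 * \<gamma> = w + 1 / w + lorentz v * lorentz v' * (norm (v - v'))\<^sup>2"
    using relative_lorentz_eq[OF v] by (simp add: \<gamma>_def w_def)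
  \<comment> \<open>Different velocities make the relative Lorentz factor exceed \<open>1\<close>; with equal velocities, the
    density or the pressure must differ.\<close>
  have differ: "1 < \<gamma> \<or> r \<noteq> 1 \<or> q \<noteq> 1"
  proof (cases "v = v'")
    case True
    then show ?thesis using neq pos by (auto simp: Qe Qe' r_def q_def)
  next
    case False
    then have "0 < lorentz v * lorentz v' * (norm (v - v'))\<^sup>2" using W by simp
    moreover have "0 \<le> (w - 1)\<^sup>2 / w" using w by simp
    ultimately show ?thesis using g add_inverse_eq[OF w] by linarith
  qed
  have "w + 1 / w \<le> 2 * \<gamma>" using g W by simp
  with w have "0 < \<rho>' * lorentz v' * (- ln q - \<Gamma> * ln r - \<Gamma> + (\<Gamma> - 1) * z * (\<gamma> - 1)
      + r * q * (\<Gamma> * \<gamma> - (\<Gamma> - 1) * w) + (\<Gamma> - 1) * r * w)"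
    using pos W
    by (intro mult_pos_pos relative_entropy_scalar_pos \<Gamma> differ) (simp_all add: r_def q_def z_def)
  then have "0 < (\<Gamma> - 1) * (entropy_of_prim \<Gamma> Q' - entropy_vars_of_prim \<Gamma> Q \<bullet> cons_of_prim \<Gamma> Q'
              + \<rho> * lorentz v)"
    unfolding Qe Qe' relative_entropy_of_prim[OF Q[unfolded Qe] Q'[unfolded Qe'] \<Gamma>(1)]
      r_def q_def w_def z_def \<gamma>_def .
  with \<Gamma> have "0 < entropy_of_prim \<Gamma> Q' - entropy_vars_of_prim \<Gamma> Q \<bullet> cons_of_prim \<Gamma> Q' + \<rho> * lorentz v"
    by (simp add: zero_less_mult_iff)
  moreover have "entropy_vars_of_prim \<Gamma> Q \<bullet> cons_of_prim \<Gamma> Q - entropy_of_prim \<Gamma> Q = \<rho> * lorentz v"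
    using potential_of_prim[OF Q[unfolded Qe] \<Gamma>(1)] by (simp only: Qe)
  ultimately show ?thesis by (simp add: inner_diff_right)
qed

text \<open>
  Two primitive states with the same conservative state would satisfy the strict tangent inequality
  in both orders, with vanishing left-hand sides.
\<close>

lemma inj_on_cons_of_prim:
  assumes "1 < \<Gamma>" "\<Gamma> \<le> 2"
  shows "inj_on (cons_of_prim \<Gamma>) physical_prim"
proof (rule inj_onI, rule ccontr)
  fix Q Q' assume Q: "Q \<in> physical_prim" "Q' \<in> physical_prim"
    and eq: "cons_of_prim \<Gamma> Q = cons_of_prim \<Gamma> Q'" and "Q \<noteq> Q'"
  then show False
    using entropy_of_prim_strictly_above_tangent[of Q Q' \<Gamma>]
      entropy_of_prim_strictly_above_tangent[of Q' Q \<Gamma>] assms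
    by simp
qed

lemma prim_of_cons_inverse:
  assumes "U \<in> physical \<Gamma>" "1 < \<Gamma>" "\<Gamma> \<le> 2"
  shows "prim_of_cons \<Gamma> U \<in> physical_prim" "cons_of_prim \<Gamma> (prim_of_cons \<Gamma> U) = U"
  using assms inj_on_cons_of_prim[of \<Gamma>] unfolding physical_def prim_of_cons_def
  by (blast intro: the_inv_into_into, blast intro: f_the_inv_into_f)

lemma eta_above_tangent:
  assumes "U \<in> physical \<Gamma>" "U' \<in> physical \<Gamma>" "1 < \<Gamma>" "\<Gamma> \<le> 2"
  shows "entropy_vars \<Gamma> U \<bullet> (U' - U) \<le> eta \<Gamma> U' - eta \<Gamma> U"
proof (cases "prim_of_cons \<Gamma> U = prim_of_cons \<Gamma> U'")
  case True
  then have "U = U'" using prim_of_cons_inverse assms by metis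
  then show ?thesis by simp
next
  case False
  then show ?thesis
    using entropy_of_prim_strictly_above_tangent[OF _ _ False assms(3,4)]
      prim_of_cons_inverse[of U \<Gamma>] prim_of_cons_inverse[of U' \<Gamma>] assms
    by (simp add: eta_eq_entropy_of_prim entropy_vars_eq_of_prim)
qed


section \<open>The entropy variables are the gradient of the entropy\<close>

lemma continuous_on_lorentz:
  assumes "continuous_on S f" "\<And>x. x \<in> S \<Longrightarrow> norm (f x) < 1"
  shows "continuous_on S (\<lambda>x. lorentz (f x))"
proof -
  have "sqrt (1 - (norm (f x))\<^sup>2) \<noteq> 0" if "x \<in> S" for x
    using one_minus_norm_sq_pos[OF assms(2)[OF that]] by simp
  then show ?thesis
    unfolding lorentz_def by (intro continuous_intros assms(1)) auto
qed

lemma physical_prim_iff: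
  "Q \<in> physical_prim \<longleftrightarrow> 0 < fst Q \<and> norm (fst (snd Q)) < 1 \<and> 0 < snd (snd Q)"
  by (cases Q) (simp add: physical_prim_def)

lemma open_physical_prim: "open physical_prim"
proof -
  have "physical_prim = {0<..} \<times> ball 0 1 \<times> {0<..}"
    by (auto simp: physical_prim_def)
  moreover have "open ({0::real<..} \<times> ball (0::real^3) 1 \<times> {0::real<..})"
    by (intro open_Times open_greaterThan open_ball)
  ultimately show ?thesis by simp
qed

lemma continuous_on_cons_of_prim:
  assumes "1 < \<Gamma>"
  shows "continuous_on physical_prim (cons_of_prim \<Gamma>)"
proof -
  have "cons_of_prim \<Gamma> = (\<lambda>Q. let \<rho> = fst Q; v = fst (snd Q); p = snd (snd Q); W = lorentz v;
      D = \<rho> * W; H = enthalpy \<Gamma> \<rho> p in (D, (D * H * W) *\<^sub>R v, D * H * W - p))"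
    by (auto simp: fun_eq_iff Let_def)
  then show ?thesis
    using assms unfolding Let_def enthalpy_def internal_energy_def
    by (auto intro!: continuous_intros continuous_on_lorentz simp: physical_prim_iff)
qed

lemma continuous_on_entropy_vars_of_prim:
  assumes "1 < \<Gamma>"
  shows "continuous_on physical_prim (entropy_vars_of_prim \<Gamma>)"
  using assms unfolding entropy_vars_of_prim_def split_beta
  by (auto intro!: continuous_intros continuous_on_lorentz simp: physical_prim_iff)

text \<open>
  Recovering the primitive variables amounts to solving a nonlinear equation. Invariance of domain
  gives continuity of the solution without any estimate on that equation.
\<close>

lemma continuous_on_prim_of_cons:
  assumes "1 < \<Gamma>" "\<Gamma> \<le> 2"
  shows "continuous_on (physical \<Gamma>) (prim_of_cons \<Gamma>)"
proof -
  obtain g where g: "homeomorphism physical_prim (physical \<Gamma>) (cons_of_prim \<Gamma>) g"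
    using invariance_of_domain_homeomorphism[OF open_physical_prim continuous_on_cons_of_prim _
        inj_on_cons_of_prim, of \<Gamma>] assms
    unfolding physical_def by auto
  have "g U = prim_of_cons \<Gamma> U" if "U \<in> physical \<Gamma>" for U
    using g that inj_on_cons_of_prim[OF assms] prim_of_cons_inverse[OF that assms]
    by (metis homeomorphism_apply1)
  with g show ?thesis
    by (metis continuous_on_cong homeomorphism_cont2)
qed

lemma continuous_on_entropy_vars:
  assumes "1 < \<Gamma>" "\<Gamma> \<le> 2"
  shows "continuous_on (physical \<Gamma>) (entropy_vars \<Gamma>)"
  unfolding entropy_vars_eq_of_prim
  by (rule continuous_on_compose2[OF continuous_on_entropy_vars_of_prim continuous_on_prim_of_cons])
    (use assms prim_of_cons_inverse in auto)

text \<open>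
  The subgradient inequalities at \<open>a\<close> and at \<open>y\<close> confine the linearisation error at \<open>y\<close> between
  \<open>0\<close> and \<open>(V y - V a)\<^sup>T (y - a)\<close>, which is \<open>o(\<parallel>y - a\<parallel>)\<close> by continuity of \<open>V\<close>.
\<close>

lemma has_derivative_continuous_subgradient:
  fixes f :: "'a::real_inner \<Rightarrow> real"
  assumes sub: "\<And>x y. x \<in> S \<Longrightarrow> y \<in> S \<Longrightarrow> V x \<bullet> (y - x) \<le> f y - f x"
    and cont: "continuous_on S V" and a: "a \<in> S"
  shows "(f has_derivative (\<lambda>h. V a \<bullet> h)) (at a within S)"
  unfolding has_derivative_within
proof
  show "bounded_linear (\<lambda>h. V a \<bullet> h)" by (rule bounded_linear_inner_right)
  have bound: "norm ((1 / norm (y - a)) *\<^sub>R (f y - (f a + V a \<bullet> (y - a)))) \<le> norm (V y - V a)"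
    if y: "y \<in> S" for y
  proof (cases "y = a")
    case False
    have "0 \<le> f y - f a - V a \<bullet> (y - a)" using sub[OF a y] by simp
    moreover have "f y - f a - V a \<bullet> (y - a) \<le> (V y - V a) \<bullet> (y - a)"
      using sub[OF y a] by (simp add: inner_diff_left inner_diff_right)
    ultimately have "\<bar>f y - (f a + V a \<bullet> (y - a))\<bar> \<le> norm (V y - V a) * norm (y - a)"
      using norm_cauchy_schwarz[of "V y - V a" "y - a"] by linarith
    with False show ?thesis by (simp add: divide_le_eq)
  qed simp
  have "((\<lambda>y. norm (V y - V a)) \<longlongrightarrow> 0) (at a within S)"
    using cont a by (auto simp: continuous_on intro!: tendsto_eq_intros)
  then show "((\<lambda>y. (1 / norm (y - a)) *\<^sub>R (f y - (f a + V a \<bullet> (y - a)))) \<longlongrightarrow> 0) (at a within S)"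
    by (rule Lim_null_comparison[rotated]) (use bound in \<open>auto simp: eventually_at_filter\<close>)
qed

lemma has_derivative_eta:
  assumes "U \<in> physical \<Gamma>" "1 < \<Gamma>" "\<Gamma> \<le> 2"
  shows "(eta \<Gamma> has_derivative (\<lambda>h. entropy_vars \<Gamma> U \<bullet> h)) (at U within physical \<Gamma>)"
  using eta_above_tangent continuous_on_entropy_vars assms
  by (intro has_derivative_continuous_subgradient) auto

text \<open>
  The derivative of \<open>U = JU / J\<close> contributes \<open>- J' V\<^sup>T U\<close>, which combines with \<open>J' \<eta>\<close> to
  \<open>- \<phi> J'\<close>.
\<close>

lemma has_real_derivative_cell_entropy:
  assumes \<Gamma>: "1 < \<Gamma>" "\<Gamma> \<le> 2" and t: "t \<in> T"
    and phys: "\<And>\<tau>. \<tau> \<in> T \<Longrightarrow> 0 < j \<tau> \<and> ju \<tau> /\<^sub>R j \<tau> \<in> physical \<Gamma>"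
    and ju: "(ju has_vector_derivative ju') (at t within T)"
    and j: "(j has_real_derivative j') (at t within T)"
  shows "((\<lambda>\<tau>. j \<tau> * eta \<Gamma> (ju \<tau> /\<^sub>R j \<tau>)) has_real_derivative
    entropy_vars \<Gamma> (ju t /\<^sub>R j t) \<bullet> ju' - potential \<Gamma> (ju t /\<^sub>R j t) * j') (at t within T)"
proof -
  define U where "U = (\<lambda>\<tau>. ju \<tau> /\<^sub>R j \<tau>)"
  define V where "V = entropy_vars \<Gamma> (U t)"
  have jt: "0 < j t" using phys t by simp
  have "(U has_vector_derivative (inverse (j t) *\<^sub>R ju' + (- (j' / (j t)\<^sup>2)) *\<^sub>R ju t)) (at t within T)"
    unfolding U_def using jt
    by (intro has_vector_derivative_scaleR ju)
      (auto intro!: derivative_eq_intros j simp: power2_eq_square field_simps)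
  moreover have "U ` T \<subseteq> physical \<Gamma>" using phys by (auto simp: U_def)
  ultimately have "((\<lambda>\<tau>. eta \<Gamma> (U \<tau>)) has_derivative
      (\<lambda>h. V \<bullet> (h *\<^sub>R (inverse (j t) *\<^sub>R ju' + (- (j' / (j t)\<^sup>2)) *\<^sub>R ju t)))) (at t within T)"
    unfolding has_vector_derivative_def V_def
    using has_derivative_eta[of "U t" \<Gamma>] \<Gamma> t
    by (intro has_derivative_in_compose[where f = U and g = "eta \<Gamma>"])
      (auto intro: has_derivative_subset)
  then have deriv: "((\<lambda>\<tau>. eta \<Gamma> (U \<tau>)) has_real_derivative
      (V \<bullet> ju' - j' * (V \<bullet> U t)) / j t) (at t within T)"
    unfolding has_field_derivative_def
    by (rule has_derivative_eq_rhs)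
      (use jt in \<open>simp add: fun_eq_iff U_def inner_add_right inner_diff_right field_simps power2_eq_square\<close>)
  have "((\<lambda>\<tau>. j \<tau> * eta \<Gamma> (U \<tau>)) has_real_derivative V \<bullet> ju' - potential \<Gamma> (U t) * j') (at t within T)"
    by (rule DERIV_cong[OF DERIV_mult[OF j deriv]])
      (use jt in \<open>simp add: potential_def V_def diff_divide_distrib algebra_simps\<close>)
  then show ?thesis by (simp add: U_def V_def)
qed


section \<open>Discrete surface conservation laws\<close>

lemma delta_commute: "delta m (delta n a) P = delta n (delta m a) P"
  by (simp add: delta_def algebra_simps)

lemma delta_diff: "delta m (\<lambda>Q. a Q - b Q) P = delta m a P - delta m b P"
  by (simp add: delta_def)

lemma index_3_add:
  "(1::3) + 1 = 2" "(1::3) + 2 = 3" "(2::3) + 1 = 3" "(2::3) + 2 = 1" "(3::3) + 1 = 1" "(3::3) + 2 = 2"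
  by simp_all

text \<open>
  The divergence of a curl vanishes: each \<open>G m\<close> occurs twice, under the two orders of the
  differences in the other two directions, with opposite signs.
\<close>

lemma sum_commuting_curl:
  fixes G :: "3 \<Rightarrow> real^3 \<Rightarrow> 'a::real_vector"
  shows "(\<Sum>k\<in>UNIV. delta k (\<lambda>P. delta (k + 2) (G (k + 1)) P - delta (k + 1) (G (k + 2)) P) P) = 0"
  unfolding sum_3 index_3_add delta_diff
  using delta_commute[of 1 2 "G 3" P] delta_commute[of 1 3 "G 2" P] delta_commute[of 2 3 "G 1" P]
  by simp

text \<open>
  The step size \<open>\<Delta>\<xi>\<^sub>k\<close> completes the prefactor of the \<open>k\<close>-th metric to the reciprocal cell volume,
  which is the same for all \<open>k\<close>; what remains is the divergence of a curl.
\<close>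

lemma surface_conservation_law:
  "(\<Sum>k\<in>UNIV. (1 / \<Delta>\<xi> $ k) * (spatial_metric \<Delta>\<xi> x k l (i + axis k (1/2))
                              - spatial_metric \<Delta>\<xi> x k l (i - axis k (1/2)))) = 0"
proof -
  define G where "G = (\<lambda>m Q. delta m (\<lambda>Q. x Q $ (l + 1)) Q * mu m (\<lambda>Q. x Q $ (l + 2)) Q)"
  define vol where "vol = \<Delta>\<xi> $ 1 * (\<Delta>\<xi> $ 2 * \<Delta>\<xi> $ 3)"
  define curl where
    "curl = (\<lambda>k P. delta (k + 2) (G (k + 1)) P - delta (k + 1) (G (k + 2)) P)"
  have vol_cyclic: "vol = \<Delta>\<xi> $ k * (\<Delta>\<xi> $ (k + 1) * \<Delta>\<xi> $ (k + 2))" for k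
  proof -
    have "\<forall>k. vol = \<Delta>\<xi> $ k * (\<Delta>\<xi> $ (k + 1) * \<Delta>\<xi> $ (k + 2))"
      unfolding forall_3 index_3_add vol_def by (simp add: ac_simps)
    then show ?thesis ..
  qed
  have metric: "spatial_metric \<Delta>\<xi> x k l P = 1 / (\<Delta>\<xi> $ (k + 1) * \<Delta>\<xi> $ (k + 2)) * curl k P" for k P
    by (simp only: spatial_metric_def Let_def curl_def G_def)
  have "(1 / \<Delta>\<xi> $ k) * (spatial_metric \<Delta>\<xi> x k l (i + axis k (1/2))
          - spatial_metric \<Delta>\<xi> x k l (i - axis k (1/2))) = (1 / vol) * delta k (curl k) i" for k
    unfolding metric vol_cyclic[of k] delta_def right_diff_distrib[symmetric] mult.assoc[symmetric]
    by simp
  then have "(\<Sum>k\<in>UNIV. (1 / \<Delta>\<xi> $ k) * (spatial_metric \<Delta>\<xi> x k l (i + axis k (1/2))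
          - spatial_metric \<Delta>\<xi> x k l (i - axis k (1/2)))) = (\<Sum>k\<in>UNIV. (1 / vol) * delta k (curl k) i)"
    by (rule sum.cong[OF refl])
  also have "\<dots> = (1 / vol) * (\<Sum>k\<in>UNIV. delta k (curl k) i)"
    by (rule sum_distrib_left[symmetric])
  also have "(\<Sum>k\<in>UNIV. delta k (curl k) i) = 0"
    unfolding curl_def by (rule sum_commuting_curl)
  finally show ?thesis by simp
qed


section \<open>Entropy conservation\<close>

text \<open>
  The value of \<open>V\<close> in the lower or upper cell is the mean minus or plus half the jump; the mean is
  the part that defines the entropy flux, and the flux condition evaluates the jump.
\<close>

lemma cell_entropy_flux:
  assumes ec: "ec_condition \<Gamma> f a b UL UR"
  shows lower_cell_entropy_flux: "entropy_vars \<Gamma> UL \<bullet> f a b UL UR =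
      num_entropy_flux \<Gamma> f a b UL UR + a * potential \<Gamma> UL + (\<Sum>l\<in>UNIV. b $ l * flux_potential \<Gamma> l UL)"
    and upper_cell_entropy_flux: "entropy_vars \<Gamma> UR \<bullet> f a b UL UR =
      num_entropy_flux \<Gamma> f a b UL UR + a * potential \<Gamma> UR + (\<Sum>l\<in>UNIV. b $ l * flux_potential \<Gamma> l UR)"
proof -
  define L R where "L = entropy_vars \<Gamma> UL \<bullet> f a b UL UR" and "R = entropy_vars \<Gamma> UR \<bullet> f a b UL UR"
  define \<psi>L \<psi>R where "\<psi>L = (\<Sum>l\<in>UNIV. b $ l * flux_potential \<Gamma> l UL)"
    and "\<psi>R = (\<Sum>l\<in>UNIV. b $ l * flux_potential \<Gamma> l UR)"
  have jump: "R - L = a * potential \<Gamma> UR - a * potential \<Gamma> UL + (\<psi>R - \<psi>L)"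
    using ec by (simp add: ec_condition_def L_def R_def \<psi>L_def \<psi>R_def inner_diff_left
        right_diff_distrib sum_subtractf)
  have mean: "num_entropy_flux \<Gamma> f a b UL UR
      = (L + R) / 2 - (a * potential \<Gamma> UL + a * potential \<Gamma> UR) / 2 - (\<psi>L + \<psi>R) / 2"
    by (simp add: num_entropy_flux_def L_def R_def \<psi>L_def \<psi>R_def inner_add_left
        distrib_left add_divide_distrib sum.distrib sum_divide_distrib)
  show "entropy_vars \<Gamma> UL \<bullet> f a b UL UR = num_entropy_flux \<Gamma> f a b UL UR + a * potential \<Gamma> UL + \<psi>L"
    and "entropy_vars \<Gamma> UR \<bullet> f a b UL UR = num_entropy_flux \<Gamma> f a b UL UR + a * potential \<Gamma> UR + \<psi>R"
    using jump unfolding mean L_def[symmetric] R_def[symmetric] \<psi>L_def[symmetric] \<psi>R_def[symmetric]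
    by argo+
qed

lemma consistent_num_entropy_flux:
  assumes "consistent_flux \<Gamma> f (\<lambda>U. U) (flux \<Gamma>) a b"
  shows "consistent_flux \<Gamma> (num_entropy_flux \<Gamma> f) (eta \<Gamma>) (entropy_flux \<Gamma>) a b"
  unfolding consistent_flux_def
proof
  fix U assume "U \<in> physical \<Gamma>"
  then have f: "f a b U U = a *\<^sub>R U + (\<Sum>l\<in>UNIV. (b $ l) *\<^sub>R flux \<Gamma> l U)"
    using assms by (simp add: consistent_flux_def)
  have "(1/2) *\<^sub>R (entropy_vars \<Gamma> U + entropy_vars \<Gamma> U) = entropy_vars \<Gamma> U"
    by (simp flip: scaleR_2)
  then have "num_entropy_flux \<Gamma> f a b U U = entropy_vars \<Gamma> U \<bullet> f a b U U - a * potential \<Gamma> U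
      - (\<Sum>l\<in>UNIV. b $ l * flux_potential \<Gamma> l U)"
    by (simp add: num_entropy_flux_def)
  then show "num_entropy_flux \<Gamma> f a b U U = a *\<^sub>R eta \<Gamma> U + (\<Sum>l\<in>UNIV. (b $ l) *\<^sub>R entropy_flux \<Gamma> l U)"
    by (simp add: f potential_def flux_potential_def inner_add_right inner_sum_right
        sum_subtractf right_diff_distrib)
qed

text \<open>
  Within one cell the potentials \<open>\<phi>\<close> and \<open>\<psi>\<^sub>l\<close> are the same at all faces, so they factor out of the
  sum over the faces, and the factor of \<open>\<psi>\<^sub>l\<close> vanishes by the \<open>l\<close>-th surface conservation law.
\<close>

lemma flux_difference_entropy_balance:
  fixes V :: state and \<psi> :: "3 \<Rightarrow> real"
  assumes
    "\<And>k P. P = i + axis k (1/2) \<or> P = i - axis k (1/2) \<Longrightarrow>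
       V \<bullet> F k P t = q k P t + a k P t * \<phi> + (\<Sum>l\<in>UNIV. metric_row \<Delta>\<xi> x k P $ l * \<psi> l)"
  shows "V \<bullet> flux_difference \<Delta>\<xi> F i t = flux_difference \<Delta>\<xi> q i t + \<phi> * flux_difference \<Delta>\<xi> a i t"
proof -
  define M where "M k l = (1 / \<Delta>\<xi> $ k) * (spatial_metric \<Delta>\<xi> x k l (i + axis k (1/2))
    - spatial_metric \<Delta>\<xi> x k l (i - axis k (1/2)))" for k l
  have face: "(1 / \<Delta>\<xi> $ k) * (V \<bullet> F k (i + axis k (1/2)) t - V \<bullet> F k (i - axis k (1/2)) t)
    = (1 / \<Delta>\<xi> $ k) * (q k (i + axis k (1/2)) t - q k (i - axis k (1/2)) t)
      + \<phi> * ((1 / \<Delta>\<xi> $ k) * (a k (i + axis k (1/2)) t - a k (i - axis k (1/2)) t))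
      + (\<Sum>l\<in>UNIV. \<psi> l * M k l)" for k
  proof -
    have "(\<Sum>l\<in>UNIV. \<psi> l * M k l)
        = (1 / \<Delta>\<xi> $ k) * ((\<Sum>l\<in>UNIV. metric_row \<Delta>\<xi> x k (i + axis k (1/2)) $ l * \<psi> l)
                         - (\<Sum>l\<in>UNIV. metric_row \<Delta>\<xi> x k (i - axis k (1/2)) $ l * \<psi> l))"
      unfolding sum_subtractf[symmetric] sum_distrib_left
      by (intro sum.cong refl) (simp add: M_def metric_row_def right_diff_distrib ac_simps)
    then show ?thesis
      unfolding assms[OF disjI1[OF refl]] assms[OF disjI2[OF refl]]
      by (simp only: right_diff_distrib distrib_left) (simp add: ac_simps)
  qed
  have "V \<bullet> flux_difference \<Delta>\<xi> F i t
      = (\<Sum>k\<in>UNIV. (1 / \<Delta>\<xi> $ k) * (V \<bullet> F k (i + axis k (1/2)) t - V \<bullet> F k (i - axis k (1/2)) t))"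
    by (simp add: flux_difference_def inner_sum_right inner_diff_right)
  also have "\<dots> = flux_difference \<Delta>\<xi> q i t + \<phi> * flux_difference \<Delta>\<xi> a i t
       + (\<Sum>k\<in>UNIV. \<Sum>l\<in>UNIV. \<psi> l * M k l)"
    unfolding face flux_difference_def by (simp only: sum.distrib sum_distrib_left real_scaleR_def)
  also have "(\<Sum>k\<in>UNIV. \<Sum>l\<in>UNIV. \<psi> l * M k l) = (\<Sum>l\<in>UNIV. \<psi> l * (\<Sum>k\<in>UNIV. M k l))"
    unfolding sum_distrib_left by (rule sum.swap)
  also have "\<dots> = 0"
    unfolding M_def surface_conservation_law by simp
  finally show ?thesis by simp
qed

lemma entropy_balance_of_scheme:
  fixes J :: "real^3 \<Rightarrow> real \<Rightarrow> real" and JU :: "real^3 \<Rightarrow> real \<Rightarrow> state"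
  assumes \<Gamma>: "1 < \<Gamma>" "\<Gamma> \<le> 2"
    and phys: "\<And>i t. i \<in> C \<Longrightarrow> t \<in> T \<Longrightarrow> 0 < J i t \<and> cell_state J JU i t \<in> physical \<Gamma>"
    and ec: "\<And>k P t. (k, P) \<in> interfaces C \<Longrightarrow> t \<in> T \<Longrightarrow>
           ec_condition \<Gamma> (F k) (Jt k P t) (metric_row \<Delta>\<xi> (x t) k P)
             (cell_state J JU (P - axis k (1/2)) t) (cell_state J JU (P + axis k (1/2)) t)"
    and scheme: "solves_scheme \<Delta>\<xi> C T Jt (interface_value \<Delta>\<xi> x Jt (cell_state J JU) F) J JU"
  shows "satisfies_entropy_balance \<Gamma> \<Delta>\<xi> C T
           (interface_value \<Delta>\<xi> x Jt (cell_state J JU) (\<lambda>k. num_entropy_flux \<Gamma> (F k))) J JU"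
  unfolding satisfies_entropy_balance_def
proof (intro ballI)
  fix i t assume i: "i \<in> C" and t: "t \<in> T"
  let ?U = "cell_state J JU"
  let ?V = "entropy_vars \<Gamma> (?U i t)"
  let ?\<phi> = "potential \<Gamma> (?U i t)"
  let ?F = "interface_value \<Delta>\<xi> x Jt ?U F"
  let ?q = "interface_value \<Delta>\<xi> x Jt ?U (\<lambda>k. num_entropy_flux \<Gamma> (F k))"
  have deriv: "((\<lambda>\<tau>. J i \<tau> * eta \<Gamma> (?U i \<tau>)) has_real_derivative
      ?V \<bullet> (- flux_difference \<Delta>\<xi> ?F i t) - ?\<phi> * (- flux_difference \<Delta>\<xi> Jt i t)) (at t within T)"
    using phys i t scheme
    by (intro has_real_derivative_cell_entropy[OF \<Gamma> t, of "J i" "JU i", folded cell_state_def[of J JU i]])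
      (auto simp: solves_scheme_def)
  have "?V \<bullet> ?F k P t = ?q k P t + Jt k P t * ?\<phi>
      + (\<Sum>l\<in>UNIV. metric_row \<Delta>\<xi> (x t) k P $ l * flux_potential \<Gamma> l (?U i t))"
    if "P = i + axis k (1/2) \<or> P = i - axis k (1/2)" for k P
    using that
  proof
    assume P: "P = i + axis k (1/2)"
    then have "(k, P) \<in> interfaces C" using i by (simp add: interfaces_def)
    from lower_cell_entropy_flux[OF ec[OF this t]] P show ?thesis
      by (simp add: interface_value_def)
  next
    assume P: "P = i - axis k (1/2)"
    then have "(k, P) \<in> interfaces C" using i by (simp add: interfaces_def)
    from upper_cell_entropy_flux[OF ec[OF this t]] P show ?thesis
      by (simp add: interface_value_def)
  qed
  from flux_difference_entropy_balance[where F = ?F and q = ?q and a = Jt, OF this] deriv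
  show "((\<lambda>\<tau>. J i \<tau> * eta \<Gamma> (?U i \<tau>)) has_real_derivative - flux_difference \<Delta>\<xi> ?q i t) (at t within T)"
    by (simp add: inner_minus_right)
qed

theorem lemma3p1:
  fixes \<Gamma> :: real
    and \<Delta>\<xi> :: "real^3"
    and C :: "(real^3) set"
    and T :: "real set"
    and x :: "real \<Rightarrow> real^3 \<Rightarrow> real^3"
    and Jt :: "3 \<Rightarrow> real^3 \<Rightarrow> real \<Rightarrow> real"
    and F :: "3 \<Rightarrow> state two_point"
    and J :: "real^3 \<Rightarrow> real \<Rightarrow> real"
    and JU :: "real^3 \<Rightarrow> real \<Rightarrow> state"
  assumes "1 < \<Gamma>" and "\<Gamma> \<le> 2"
    and "\<forall>k. 0 < \<Delta>\<xi> $ k"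
    and "C \<subseteq> cell_lattice"
    and "is_interval T"
    and "\<forall>i\<in>cells_and_neighbours C. \<forall>t\<in>T. 0 < J i t \<and> cell_state J JU i t \<in> physical \<Gamma>"
    and "\<forall>(k, P)\<in>interfaces C. \<forall>t\<in>T.
           symmetric_flux \<Gamma> (F k) (Jt k P t) (metric_row \<Delta>\<xi> (x t) k P)"
    and "\<forall>(k, P)\<in>interfaces C. \<forall>t\<in>T.
           consistent_flux \<Gamma> (F k) (\<lambda>U. U) (flux \<Gamma>) (Jt k P t) (metric_row \<Delta>\<xi> (x t) k P)"
    and "\<forall>(k, P)\<in>interfaces C. \<forall>t\<in>T.
           ec_condition \<Gamma> (F k) (Jt k P t) (metric_row \<Delta>\<xi> (x t) k P)
             (cell_state J JU (P - axis k (1/2)) t) (cell_state J JU (P + axis k (1/2)) t)"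
    and "solves_scheme \<Delta>\<xi> C T Jt (interface_value \<Delta>\<xi> x Jt (cell_state J JU) F) J JU"
  shows "satisfies_entropy_balance \<Gamma> \<Delta>\<xi> C T
           (interface_value \<Delta>\<xi> x Jt (cell_state J JU) (\<lambda>k. num_entropy_flux \<Gamma> (F k))) J JU \<and>
         (\<forall>(k, P)\<in>interfaces C. \<forall>t\<in>T.
           consistent_flux \<Gamma> (num_entropy_flux \<Gamma> (F k)) (eta \<Gamma>) (entropy_flux \<Gamma>)
             (Jt k P t) (metric_row \<Delta>\<xi> (x t) k P))"
proof -
  have "satisfies_entropy_balance \<Gamma> \<Delta>\<xi> C T
          (interface_value \<Delta>\<xi> x Jt (cell_state J JU) (\<lambda>k. num_entropy_flux \<Gamma> (F k))) J JU"
    by (rule entropy_balance_of_scheme) (use assms in \<open>auto simp: cells_and_neighbours_def\<close>)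
  moreover have "\<forall>(k, P)\<in>interfaces C. \<forall>t\<in>T.
      consistent_flux \<Gamma> (num_entropy_flux \<Gamma> (F k)) (eta \<Gamma>) (entropy_flux \<Gamma>)
        (Jt k P t) (metric_row \<Delta>\<xi> (x t) k P)"
    using assms(8) consistent_num_entropy_flux by fastforce
  ultimately show ?thesis ..
qed

end
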